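(* Let $p$ be a prime, $n\ge 1$, $q=p^n$, and let $\gamma\in\mathbb{F}_q^*$ have multiplicative order $T$; put $G=\langle\gamma\rangle$. Let $(\beta_1,\ldots,\beta_n)$ be an ordered basis of $\mathbb{F}_q$ over $\mathbb{F}_p$ and let $P:G\to\mathbb{F}_q$ be the map $P(\gamma^x)=\xi_x$ for $x=0,1,\ldots,T-1$. Let $m$ be an integer with $0\le m\le T$ and $F:\mathbb{F}_q\to\mathbb{F}_q$ a map with $F(\zeta)=P(\zeta)$ for all but at most $m$ elements $\zeta\in G$. Suppose there exist an $\mathbb{F}_p$-linear subspace $U\le\mathbb{F}_q$ of codimension $k$, a linearised polynomial $M\in\mathbb{F}_q[X]$ and constants $a_V\in\mathbb{F}_q$ indexed by the cosets $V$ of $U$, such that $F(\zeta)=M(\zeta)+a_{U+\zeta}$ for all $\zeta\in\mathbb{F}_q$. Assume that $\gamma-1\in rG=\{\sum_{i=1}^r\zeta_i:(\zeta_1,\ldots,\zeta_r)\in G^r\}$ for an integer $r$ coprime to $p$, and that $m<\frac{T-1}{r+2}$. Then $$p^k\ge\left(\frac{T-(r+2)m-1}{rn}\right)^{1/(r+1)}.$$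
   Context: A linearised polynomial over $\mathbb{F}_q$ is one of the form $\sum_{j=0}^{n-1}c_jX^{p^j}$, $c_j\in\mathbb{F}_q$. For an integer $0\le x\le q-1$ with base-$p$ expansion $x=x_1+x_2p+\cdots+x_np^{n-1}$, $0\le x_i<p$, one sets $\xi_x=x_1\beta_1+\cdots+x_n\beta_n\in\mathbb{F}_q$. *)

theory Defs
  imports
    Complex_Main
    "HOL-Computational_Algebra.Polynomial"
    "Berlekamp_Zassenhaus.Finite_Field"
begin

text \<open>
  The field with \<open>p\<close> elements is the type \<open>'p mod_ring\<close> with \<open>CARD('p) = p\<close>. It acts on a field of
  characteristic \<open>p\<close> through the representatives \<open>0, \<dots>, p - 1\<close> of the residue classes. This is a
  vector space structure exactly when the characteristic of the field is \<open>p\<close>; then subspaces,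
  bases and dimensions over the prime field are the library's notions for this scalar action.
\<close>

definition fp_scale :: "'p::prime_card itself \<Rightarrow> 'p mod_ring \<Rightarrow> 'a::finite_field \<Rightarrow> 'a" where
  "fp_scale _ c x = of_int (to_int_mod_ring c) * x"

lemma vector_space_fp_scale:
  assumes "CARD('a) = CARD('p::prime_card) ^ n"
  shows "vector_space (fp_scale TYPE('p) :: 'p mod_ring \<Rightarrow> 'a::finite_field \<Rightarrow> 'a)"
proof -
  have "CHAR('a) dvd CARD('p) ^ n"
    using CHAR_dvd_CARD[where ?'a = 'a] assms by simp
  moreover have "prime CHAR('a)" by (rule prime_CHAR_semidom) (simp add: CHAR_pos_iff)
  moreover have "prime CARD('p)" by (rule prime_card)
  ultimately have char: "CHAR('a) = CARD('p)"
    by (metis prime_dvd_power primes_dvd_imp_eq)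
  have mod: "(of_int (k mod int CARD('p)) :: 'a) = of_int k" for k
    by (simp add: char[symmetric] of_int_eq_iff_cong_CHAR)
  have add: "(of_int (to_int_mod_ring (a + b)) :: 'a)
      = of_int (to_int_mod_ring a) + of_int (to_int_mod_ring b)" for a b :: "'p mod_ring"
    unfolding of_int_add[symmetric]
    by (simp add: to_int_mod_ring.rep_eq plus_mod_ring.rep_eq mod)
  have mult: "(of_int (to_int_mod_ring (a * b)) :: 'a)
      = of_int (to_int_mod_ring a) * of_int (to_int_mod_ring b)" for a b :: "'p mod_ring"
    unfolding of_int_mult[symmetric]
    by (simp add: to_int_mod_ring.rep_eq times_mod_ring.rep_eq mod)
  show ?thesis
    by unfold_locales (simp_all add: fp_scale_def add mult algebra_simps)
qed

definition ordered_fp_basis ::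
  "'p::prime_card itself \<Rightarrow> nat \<Rightarrow> (nat \<Rightarrow> 'a::finite_field) \<Rightarrow> bool" where
  "ordered_fp_basis S n \<beta> \<longleftrightarrow>
     inj_on \<beta> {1..n} \<and>
     \<not> module.dependent (fp_scale S) (\<beta> ` {1..n}) \<and>
     module.span (fp_scale S) (\<beta> ` {1..n}) = UNIV"

definition fp_codim :: "'p::prime_card itself \<Rightarrow> 'a::finite_field set \<Rightarrow> nat" where
  "fp_codim S U =
     vector_space.dim (fp_scale S) (UNIV :: 'a set) - vector_space.dim (fp_scale S) U"

definition mult_order :: "'a::monoid_mult \<Rightarrow> nat" where
  "mult_order g = (LEAST t. 0 < t \<and> g ^ t = 1)"

definition cyclic_subgroup :: "'a::field \<Rightarrow> 'a set" where
  "cyclic_subgroup g = range (\<lambda>i::int. g powi i)"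

text \<open>
  The element \<open>\<xi>\<^sub>x\<close>; the digit \<open>x\<^sub>i\<close> of the base \<open>p\<close> expansion
  \<open>x = x\<^sub>1 + x\<^sub>2 p + \<dots> + x\<^sub>n p\<^bsup>n - 1\<^esup>\<close> is \<open>(x div p ^ (i - 1)) mod p\<close>.
\<close>

definition xi :: "nat \<Rightarrow> nat \<Rightarrow> (nat \<Rightarrow> 'a::field) \<Rightarrow> nat \<Rightarrow> 'a" where
  "xi p n \<beta> x = (\<Sum>i=1..n. of_nat ((x div p ^ (i - 1)) mod p) * \<beta> i)"

definition linearised :: "nat \<Rightarrow> nat \<Rightarrow> 'a::field poly \<Rightarrow> bool" where
  "linearised p n M \<longleftrightarrow> (\<exists>c :: nat \<Rightarrow> 'a. M = (\<Sum>j<n. monom (c j) (p ^ j)))"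

definition coset :: "'a::plus set \<Rightarrow> 'a \<Rightarrow> 'a set" where
  "coset U z = {u + z | u. u \<in> U}"

definition fold_sumset :: "nat \<Rightarrow> 'a::comm_monoid_add set \<Rightarrow> 'a set" where
  "fold_sumset r G = {(\<Sum>i=1..r. z i) | z :: nat \<Rightarrow> 'a. \<forall>i\<in>{1..r}. z i \<in> G}"

end

theory Submission
  imports Defs
begin

text \<open>
  Write \<open>\<gamma> - 1 = \<gamma>\<^bsup>e\<^sub>1\<^esup> + \<dots> + \<gamma>\<^bsup>e\<^sub>r\<^esup>\<close>. Additivity of \<open>M\<close> cancels it from
  \<open>F (\<gamma>\<^bsup>x+1\<^esup>) - F (\<gamma>\<^bsup>x\<^esup>) - \<Sum>\<^sub>i F (\<gamma>\<^bsup>x+e\<^sub>i\<^esup>)\<close>, so for all but \<open>(r + 2) m\<close> of the \<open>x < T - 1\<close> the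
  quantity \<open>\<xi>\<^sub>x\<^sub>+\<^sub>1 - \<xi>\<^sub>x - \<Sum>\<^sub>i \<xi>\<^bsub>x+e\<^sub>i\<^esub>\<close> (indices modulo \<open>T\<close>) depends only on the cosets of \<open>\<gamma>\<^bsup>x\<^esup>\<close> and of the
  \<open>\<gamma>\<^bsup>x+e\<^sub>i\<^esup>\<close>, for which there are at most \<open>(p\<^sup>k)\<^bsup>r+1\<^esup>\<close> possibilities. The difference \<open>\<xi>\<^sub>x\<^sub>+\<^sub>1 - \<xi>\<^sub>x\<close>
  takes \<open>n\<close> values, one for each length of the carry chain, and as \<open>r\<close> is prime to \<open>p\<close>, the sum
  \<open>\<Sum>\<^sub>i \<xi>\<^bsub>x+e\<^sub>i\<^esub>\<close> determines the base \<open>p\<close> digits of \<open>x\<close> one by one on each of the \<open>r\<close> arcs of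
  \<open>\<int> / T\<close> on which the wrap-around pattern is constant. Hence at most \<open>r n\<close> values of \<open>x\<close> share the
  same cosets.
\<close>

section \<open>Base-\<open>p\<close> digits and coordinates over the prime field\<close>

lemma CHAR_eq_prime_card:
  assumes "CARD('a::finite_field) = CARD('p::prime_card) ^ n"
  shows "CHAR('a) = CARD('p)"
proof -
  have "CHAR('a) dvd CARD('p) ^ n"
    using CHAR_dvd_CARD[where ?'a = 'a] assms by simp
  moreover have "prime CHAR('a)" by (rule prime_CHAR_semidom) (simp add: CHAR_pos_iff)
  moreover have "prime CARD('p)" by (rule prime_card)
  ultimately show ?thesis
    by (metis prime_dvd_power primes_dvd_imp_eq)
qed

lemma fp_scale_of_nat:
  assumes "CARD('a::finite_field) = CARD('p::prime_card) ^ n"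
  shows "fp_scale TYPE('p) (of_nat d) (x :: 'a) = of_nat d * x"
proof -
  interpret vector_space "fp_scale TYPE('p) :: 'p mod_ring \<Rightarrow> 'a \<Rightarrow> 'a"
    by (rule vector_space_fp_scale[OF assms])
  show ?thesis by (induction d) (simp_all add: scale_left_distrib algebra_simps)
qed

text \<open>Coefficients only matter modulo the characteristic, so each digit may be replaced by the
  full quotient; carries then become plain integer division.\<close>

lemma xi_eq_sum_div:
  assumes "CARD('a::finite_field) = CARD('p::prime_card) ^ n"
  shows "xi CARD('p) n (\<beta> :: nat \<Rightarrow> 'a) x = (\<Sum>i=1..n. of_nat (x div CARD('p) ^ (i - 1)) * \<beta> i)"
  unfolding xi_def CHAR_eq_prime_card[OF assms, symmetric] by simp

text \<open>Uniqueness of coordinates, in the form needed for natural-number coefficients: these are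
  determined only modulo \<open>CARD('p)\<close>.\<close>

lemma ordered_fp_basis_cong:
  fixes \<beta> :: "nat \<Rightarrow> 'a::finite_field"
  assumes card: "CARD('a) = CARD('p::prime_card) ^ n"
    and basis: "ordered_fp_basis TYPE('p) n \<beta>"
    and eq: "(\<Sum>i=1..n. of_nat (d i) * \<beta> i) = (\<Sum>i=1..n. of_nat (d' i) * \<beta> i)"
    and i: "i \<in> {1..n}"
  shows "[d i = d' i] (mod CARD('p))"
proof -
  interpret vector_space "fp_scale TYPE('p) :: 'p mod_ring \<Rightarrow> 'a \<Rightarrow> 'a"
    by (rule vector_space_fp_scale[OF card])
  have inj: "inj_on \<beta> {1..n}" and indep: "independent (\<beta> ` {1..n})"
    using basis by (auto simp: ordered_fp_basis_def)
  define c :: "nat \<Rightarrow> 'p mod_ring" where "c = (\<lambda>i. of_nat (d i) - of_nat (d' i))"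
  have "(\<Sum>v\<in>\<beta> ` {1..n}. fp_scale TYPE('p) (c (the_inv_into {1..n} \<beta> v)) v)
      = (\<Sum>i=1..n. fp_scale TYPE('p) (c i) (\<beta> i))"
    by (subst sum.reindex[OF inj]) (auto intro!: sum.cong simp: the_inv_into_f_f[OF inj] simp del: One_nat_def)
  also have "\<dots> = 0"
    using eq by (simp add: c_def scale_left_diff_distrib fp_scale_of_nat[OF card] sum_subtractf)
  finally have "c (the_inv_into {1..n} \<beta> (\<beta> i)) = 0"
    using i by (intro independentD[OF indep, of "\<beta> ` {1..n}" _ "\<beta> i"]) auto
  then have "(of_nat (d i) :: 'p mod_ring) = of_nat (d' i)"
    by (simp only: c_def the_inv_into_f_f[OF inj i] right_minus_eq)
  then show ?thesis by (simp add: of_nat_eq_iff_cong_CHAR)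
qed

text \<open>
  The digits of the shift \<open>t\<close> vanish one after the other: once \<open>p\<^sup>j\<close> divides \<open>t\<close>, adding \<open>t\<close> causes
  no carry into position \<open>j\<close>, so the digit of \<open>t\<close> there, multiplied by \<open>card A\<close>, is \<open>0\<close> modulo \<open>p\<close>.
\<close>

lemma xi_sum_shift_dvd:
  fixes \<beta> :: "nat \<Rightarrow> 'a::finite_field" and u :: "'b \<Rightarrow> nat"
  assumes card: "CARD('a) = CARD('p::prime_card) ^ n"
    and basis: "ordered_fp_basis TYPE('p) n \<beta>"
    and coprime: "coprime (card A) CARD('p)"
    and eq: "(\<Sum>l\<in>A. xi CARD('p) n \<beta> (u l + t)) = (\<Sum>l\<in>A. xi CARD('p) n \<beta> (u l))"
  shows "CARD('p) ^ n dvd t"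
proof -
  let ?p = "CARD('p)"
  have sum_xi: "(\<Sum>l\<in>A. xi ?p n \<beta> (v l))
      = (\<Sum>i=1..n. of_nat (\<Sum>l\<in>A. v l div ?p ^ (i - 1)) * \<beta> i)" for v :: "'b \<Rightarrow> nat"
    by (simp add: xi_eq_sum_div[OF card] sum_distrib_right sum.swap[of _ A])
  have digit: "[(\<Sum>l\<in>A. (u l + t) div ?p ^ (i - 1)) = (\<Sum>l\<in>A. u l div ?p ^ (i - 1))] (mod ?p)"
    if "i \<in> {1..n}" for i
    using ordered_fp_basis_cong[OF card basis eq[unfolded sum_xi] that] .
  have "?p ^ j dvd t" if "j \<le> n" for j
    using that
  proof (induction j)
    case (Suc j)
    then obtain s where s: "t = ?p ^ j * s" by (auto elim: dvdE)
    have "[(\<Sum>l\<in>A. (u l + t) div ?p ^ j) = (\<Sum>l\<in>A. u l div ?p ^ j)] (mod ?p)"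
      using digit[of "Suc j"] Suc.prems by simp
    then have "[(\<Sum>l\<in>A. u l div ?p ^ j) + card A * s = (\<Sum>l\<in>A. u l div ?p ^ j)] (mod ?p)"
      by (simp add: s sum.distrib add.commute)
    then have "?p dvd card A * s"
      by (simp add: cong_add_lcancel_0_nat cong_0_iff)
    then have "?p dvd s"
      using coprime by (simp add: coprime_commute coprime_dvd_mult_right_iff)
    then show ?case by (simp add: s mult_dvd_mono mult.commute)
  qed simp
  then show ?thesis by simp
qed

text \<open>The quotient by \<open>p ^ (i - 1)\<close> grows by one exactly when
  \<open>p ^ (i - 1)\<close> divides \<open>Suc x\<close>, that is, when the carry reaches position
  \<open>i\<close>.\<close>

lemma xi_Suc:
  fixes \<beta> :: "nat \<Rightarrow> 'a::finite_field"
  assumes card: "CARD('a) = CARD('p::prime_card) ^ n"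
  shows "xi CARD('p) n \<beta> (Suc x)
    = xi CARD('p) n \<beta> x + sum \<beta> {i \<in> {1..n}. CARD('p) ^ (i - 1) dvd Suc x}"
proof -
  have "xi CARD('p) n \<beta> (Suc x) - xi CARD('p) n \<beta> x
      = (\<Sum>i=1..n. if CARD('p) ^ (i - 1) dvd Suc x then \<beta> i else 0)"
    unfolding xi_eq_sum_div[OF card] sum_subtractf[symmetric]
    by (intro sum.cong) (auto simp: div_Suc dvd_eq_mod_eq_0 algebra_simps)
  also have "\<dots> = sum \<beta> {i \<in> {1..n}. CARD('p) ^ (i - 1) dvd Suc x}"
    by (rule sum.inter_filter[symmetric]) simp
  finally show ?thesis by (simp add: algebra_simps)
qed

lemma chain_card_inject:
  assumes "finite A" "finite B" "A \<subseteq> B \<or> B \<subseteq> A" "card A = card B"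
  shows "A = B"
  using assms by (metis card_subset_eq)

text \<open>Both sets are initial segments of \<open>{1..n}\<close>, hence nested. So the length of
  a carry chain identifies it, leaving few possible increments of \<open>xi\<close>.\<close>

lemma power_dvd_filter_card_inject:
  assumes "card {i \<in> {1..n}. (p::nat) ^ (i - 1) dvd x} = card {i \<in> {1..n}. p ^ (i - 1) dvd y}"
  shows "{i \<in> {1..n}. p ^ (i - 1) dvd x} = {i \<in> {1..n}. p ^ (i - 1) dvd y}"
proof (rule chain_card_inject[OF _ _ _ assms])
  have down: "p ^ (i - 1) dvd z" if "p ^ (j - 1) dvd z" "i \<le> j" for i j z
    using that by (meson diff_le_mono dvd_trans le_imp_power_dvd)
  show "{i \<in> {1..n}. p ^ (i - 1) dvd x} \<subseteq> {i \<in> {1..n}. p ^ (i - 1) dvd y}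
      \<or> {i \<in> {1..n}. p ^ (i - 1) dvd y} \<subseteq> {i \<in> {1..n}. p ^ (i - 1) dvd x}"
  proof (rule disjCI)
    assume "\<not> {i \<in> {1..n}. p ^ (i - 1) dvd y} \<subseteq> {i \<in> {1..n}. p ^ (i - 1) dvd x}"
    then obtain j where "j \<le> n" "p ^ (j - 1) dvd y" "\<not> p ^ (j - 1) dvd x" by auto
    then show "{i \<in> {1..n}. p ^ (i - 1) dvd x} \<subseteq> {i \<in> {1..n}. p ^ (i - 1) dvd y}"
      using down by (smt (verit, ccfv_SIG) Collect_mono mem_Collect_eq nat_le_linear subsetI)
  qed
qed auto

section \<open>Counting the cosets of a subspace\<close>

lemma coset_eq_iff:
  fixes U :: "'a::finite_field set"
  assumes "CARD('a) = CARD('p::prime_card) ^ n" "module.subspace (fp_scale TYPE('p)) U"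
  shows "coset U x = coset U y \<longleftrightarrow> x - y \<in> U"
proof -
  interpret vector_space "fp_scale TYPE('p) :: 'p mod_ring \<Rightarrow> 'a \<Rightarrow> 'a"
    by (rule vector_space_fp_scale[OF assms(1)])
  note U = assms(2)
  have sub: "coset U x \<subseteq> coset U y" if "x - y \<in> U" for x y
  proof
    fix v assume "v \<in> coset U x"
    then obtain w where "w \<in> U" "v = w + x" by (auto simp: coset_def)
    then have "w + (x - y) \<in> U" "v = w + (x - y) + y"
      using subspace_add[OF U] that by auto
    then show "v \<in> coset U y" unfolding coset_def by blast
  qed
  show ?thesis
  proof
    assume eq: "coset U x = coset U y"
    have "x \<in> coset U x" using subspace_0[OF U] by (force simp: coset_def)
    then show "x - y \<in> U" unfolding eq by (auto simp: coset_def)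
  next
    assume "x - y \<in> U"
    moreover from this have "y - x \<in> U" using subspace_neg[OF U] by force
    ultimately show "coset U x = coset U y" by (intro equalityI sub)
  qed
qed

lemma card_cosets_le:
  fixes U :: "'a::finite_field set"
  assumes card: "CARD('a) = CARD('p::prime_card) ^ n"
    and U: "module.subspace (fp_scale TYPE('p)) U"
  shows "card (range (coset U)) \<le> CARD('p) ^ fp_codim TYPE('p) U"
proof -
  interpret vector_space "fp_scale TYPE('p) :: 'p mod_ring \<Rightarrow> 'a \<Rightarrow> 'a"
    by (rule vector_space_fp_scale[OF card])
  obtain B where B: "B \<subseteq> U" "independent B" "U \<subseteq> span B" "card B = dim U"
    using basis_exists by blast
  \<comment> \<open>\<open>C\<close> completes a basis of \<open>U\<close> to one of the whole
    space, so \<open>span C\<close> meets every coset.\<close>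
  define C where "C = extend_basis B - B"
  have C: "card C = fp_codim TYPE('p) U"
  proof -
    have "dim UNIV = card (extend_basis B)"
      by (rule dim_eq_card) (simp_all add: B independent_extend_basis)
    then show ?thesis
      unfolding C_def fp_codim_def B(4)[symmetric]
      by (simp add: card_Diff_subset extend_basis_superset B)
  qed
  have "coset U x \<in> coset U ` span C" for x
  proof -
    have "x \<in> span (B \<union> C)"
      using extend_basis_superset[OF B(2)] B(2) by (simp add: C_def Un_absorb1)
    then obtain b c where "x = b + c" "b \<in> span B" "c \<in> span C"
      unfolding span_Un by blast
    moreover from this have "b \<in> U" using span_minimal[OF B(1) U] by blast
    ultimately show ?thesis
      using coset_eq_iff[OF card U, of x c] by force
  qed
  then have "range (coset U) \<subseteq> coset U ` span C" by auto
  then have "card (range (coset U)) \<le> card (coset U ` span C)"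
    by (intro card_mono) auto
  also have "\<dots> \<le> card (span C)" by (rule card_image_le) simp
  \<comment> \<open>Each element of \<open>span C\<close> comes from a coefficient function on
    \<open>C\<close>; restricting it to \<open>C\<close> makes such functions countable.\<close>
  also have "span C \<subseteq> (\<lambda>u. \<Sum>v\<in>C. fp_scale TYPE('p) (u v) v) ` (C \<rightarrow>\<^sub>E UNIV)"
  proof
    fix x assume "x \<in> span C"
    then obtain u where "x = (\<Sum>v\<in>C. fp_scale TYPE('p) (u v) v)"
      by (auto simp: span_finite)
    then show "x \<in> (\<lambda>u. \<Sum>v\<in>C. fp_scale TYPE('p) (u v) v) ` (C \<rightarrow>\<^sub>E UNIV)"
      by (intro image_eqI[of _ _ "restrict u C"]) simp_all
  qed
  then have "card (span C) \<le> card ((\<lambda>u. \<Sum>v\<in>C. fp_scale TYPE('p) (u v) v) ` (C \<rightarrow>\<^sub>E (UNIV :: 'p mod_ring set)))"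
    by (intro card_mono) (auto intro: finite_PiE)
  also have "\<dots> \<le> card (C \<rightarrow>\<^sub>E (UNIV :: 'p mod_ring set))"
    by (intro card_image_le finite_PiE) auto
  also have "\<dots> = CARD('p) ^ fp_codim TYPE('p) U"
    by (simp add: card_PiE C)
  finally show ?thesis .
qed

section \<open>Linearised polynomials and powers of a field element\<close>

lemma poly_linearised_add:
  fixes M :: "'a::finite_field poly"
  assumes "linearised CHAR('a) n M"
  shows "poly M (x + y) = poly M x + poly M y"
proof -
  have "prime CHAR('a)" by (rule prime_CHAR_semidom) (simp add: CHAR_pos_iff)
  then have "(x + y) ^ (CHAR('a) ^ j) = x ^ (CHAR('a) ^ j) + y ^ (CHAR('a) ^ j)" for j
    by (intro freshmans_dream') auto
  then show ?thesis
    using assms by (auto simp: linearised_def poly_sum poly_monom sum.distrib algebra_simps)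
qed

text \<open>The exponent \<open>CARD('a) - 1\<close> witnesses that the \<open>LEAST\<close> in
  \<open>mult_order\<close> is attained and also bounds it.\<close>

lemma mult_order_props:
  fixes g :: "'a::finite_field"
  assumes "g \<noteq> 0"
  shows "0 < mult_order g" "g ^ mult_order g = 1" "mult_order g < CARD('a)"
proof -
  have "g * g ^ (CARD('a) - 1) = g * 1"
    using finite_field_power_card_eq_same[of g] by (simp flip: power_Suc)
  then have one: "g ^ (CARD('a) - 1) = 1" using assms by simp
  have "{0, 1::'a} \<subseteq> UNIV" by simp
  then have "card {0, 1::'a} \<le> CARD('a)" by (intro card_mono) auto
  then have "1 < CARD('a)" by simp
  with one have *: "0 < CARD('a) - 1 \<and> g ^ (CARD('a) - 1) = 1" by simp
  show "0 < mult_order g" "g ^ mult_order g = 1"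
    using LeastI[of "\<lambda>t. 0 < t \<and> g ^ t = 1", OF *] by (auto simp: mult_order_def)
  have "mult_order g \<le> CARD('a) - 1"
    unfolding mult_order_def by (rule Least_le[of "\<lambda>t. 0 < t \<and> g ^ t = 1", OF *])
  with \<open>1 < CARD('a)\<close> show "mult_order g < CARD('a)" by simp
qed

lemma power_mod_mult_order:
  fixes g :: "'a::finite_field"
  assumes "g \<noteq> 0"
  shows "g ^ (x mod mult_order g) = g ^ x"
proof -
  have "g ^ x = g ^ (mult_order g * (x div mult_order g) + x mod mult_order g)" by simp
  also have "\<dots> = g ^ (x mod mult_order g)"
    unfolding power_add power_mult by (simp add: mult_order_props[OF assms])
  finally show ?thesis ..
qed

lemma inj_on_power_mult_order:
  fixes g :: "'a::finite_field"
  assumes "g \<noteq> 0"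
  shows "inj_on (\<lambda>x. g ^ x) {..<mult_order g}"
proof (rule linorder_inj_onI)
  fix x y assume "x < y" "y \<in> {..<mult_order g}"
  then have "\<not> mult_order g \<le> y - x" by auto
  then have "g ^ (y - x) \<noteq> 1"
    using \<open>x < y\<close> Least_le[of "\<lambda>t. 0 < t \<and> g ^ t = 1" "y - x"] by (auto simp: mult_order_def)
  moreover have "g ^ y = g ^ x * g ^ (y - x)" using \<open>x < y\<close> by (simp flip: power_add)
  ultimately show "g ^ x \<noteq> g ^ y" using assms by auto
qed auto

lemma cyclic_subgroup_eq:
  fixes g :: "'a::finite_field"
  assumes "g \<noteq> 0"
  shows "cyclic_subgroup g = (\<lambda>x. g ^ x) ` {..<mult_order g}"
proof safe
  let ?T = "mult_order g"
  note T = mult_order_props[OF assms]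
  fix x assume "x \<in> cyclic_subgroup g"
  then obtain i where i: "x = g powi i" by (auto simp: cyclic_subgroup_def)
  have "g powi i = g powi (int ?T * (i div int ?T) + i mod int ?T)" by simp
  also have "\<dots> = (g powi int ?T) powi (i div int ?T) * g powi (i mod int ?T)"
    using assms by (subst power_int_add) (simp_all only: power_int_mult simp_thms)
  also have "\<dots> = g powi (i mod int ?T)" by (simp add: T)
  also have "\<dots> = g powi int (nat (i mod int ?T))" using T(1) by simp
  also have "\<dots> = g ^ nat (i mod int ?T)" by (simp only: power_int_of_nat)
  finally have "x = g ^ nat (i mod int ?T)" by (simp add: i)
  moreover have "nat (i mod int ?T) < ?T" using T(1) by (simp add: nat_less_iff)
  ultimately show "x \<in> (\<lambda>x. g ^ x) ` {..<?T}" by auto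
next
  fix x show "g ^ x \<in> cyclic_subgroup g"
    unfolding cyclic_subgroup_def by (rule range_eqI[of _ _ "int x"]) simp
qed

section \<open>Cyclic shifts of exponents\<close>

text \<open>
  On a circle of length \<open>T\<close> the points where some \<open>x + e i\<close> wraps around cut out only \<open>card I\<close> arcs:
  the initial segment, where nothing wraps, and the final one, where everything does, belong to the
  same arc. This is why the wrap counts are compared modulo \<open>card I\<close>.
\<close>

lemma cyclic_shifts_const_diff:
  fixes e :: "'b \<Rightarrow> nat"
  assumes I: "finite I" and e: "\<And>i. i \<in> I \<Longrightarrow> e i < T"
    and xy: "x \<le> y" "y < T"
    and eq: "card {i \<in> I. T \<le> x + e i} mod card I = card {i \<in> I. T \<le> y + e i} mod card I"
  obtains t where "\<And>i. i \<in> I \<Longrightarrow> (y + e i) mod T = (x + e i) mod T + t"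
  | t where "\<And>i. i \<in> I \<Longrightarrow> (x + e i) mod T = (y + e i) mod T + t"
proof -
  define W where "W z = {i \<in> I. T \<le> z + e i}" for z
  have W: "finite (W z)" "W z \<subseteq> I" "card (W z) \<le> card I" for z
    using I by (auto simp: W_def intro: card_mono)
  have mod_eq: "(z + e i) mod T = (if i \<in> W z then z + e i - T else z + e i)" if "z < T" "i \<in> I" for z i
    using that e[OF that(2)] by (auto simp: W_def le_mod_geq)
  have sub: "W x \<subseteq> W y" using xy by (auto simp: W_def)
  then have le: "card (W x) \<le> card (W y)" by (intro card_mono W)
  have ge_T: "T \<le> z + e i" if "i \<in> W z" for z i using that by (simp add: W_def)
  \<comment> \<open>The two counts are ordered, lie between 0 and \<open>card I\<close>, and agree
    modulo \<open>card I\<close>: they are equal unless they are the two extremes.\<close>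
  consider "card (W x) = card (W y)" | "card (W x) = 0" "card (W y) = card I"
  proof (cases "card (W y) < card I")
    case True
    then show ?thesis using eq le that by (simp add: W_def)
  next
    case False
    then have "card (W y) = card I" using W(3)[of y] by simp
    moreover from this have "card (W x) mod card I = 0" using eq by (simp add: W_def)
    ultimately show ?thesis using that W(3)[of x]
      by (metis le_neq_implies_less mod_less)
  qed
  then show ?thesis
  proof cases
    case 1
    then have "W x = W y" using sub W(1) by (intro card_subset_eq)
    then have "(y + e i) mod T = (x + e i) mod T + (y - x)" if "i \<in> I" for i
      using that xy ge_T[of i x] by (auto simp: mod_eq)
    then show ?thesis by (rule that(1))
  next
    case 2
    then have "W x = {}" "W y = I" using W(1)[of x] card_subset_eq[OF I W(2)[of y]] by auto
    \<comment> \<open>Here the arc runs through the wrap-around, so one moves forward from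
      \<open>y\<close> to \<open>x + T\<close>.\<close>
    then have "(x + e i) mod T = (y + e i) mod T + (x + T - y)" if "i \<in> I" for i
      using that xy ge_T[of i y] by (auto simp: mod_eq)
    then show ?thesis by (rule that(2))
  qed
qed

text \<open>Equal wrap counts make all residues differ by one common shift \<open>t\<close>.
  Equality of the sums forces \<open>CARD('p) ^ n\<close> to divide \<open>t\<close>, while
  \<open>t\<close> is at most a residue below \<open>T\<close>, so \<open>t = 0\<close>.\<close>

lemma xi_cyclic_shifts_inject:
  fixes \<beta> :: "nat \<Rightarrow> 'a::finite_field" and e :: "'b \<Rightarrow> nat"
  assumes card: "CARD('a) = CARD('p::prime_card) ^ n"
    and basis: "ordered_fp_basis TYPE('p) n \<beta>"
    and I: "finite I" "coprime (card I) CARD('p)"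
    and T: "T < CARD('p) ^ n"
    and e: "\<And>i. i \<in> I \<Longrightarrow> e i < T"
    and xy: "x \<le> y" "y < T"
    and wrap: "card {i \<in> I. T \<le> x + e i} mod card I = card {i \<in> I. T \<le> y + e i} mod card I"
    and eq: "(\<Sum>i\<in>I. xi CARD('p) n \<beta> ((x + e i) mod T)) = (\<Sum>i\<in>I. xi CARD('p) n \<beta> ((y + e i) mod T))"
    and i: "i \<in> I"
  shows "(x + e i) mod T = (y + e i) mod T"
proof -
  have shift: "u i = v i"
    if uv: "\<And>i. i \<in> I \<Longrightarrow> u i = v i + t" and "u i < T"
      and sum: "(\<Sum>i\<in>I. xi CARD('p) n \<beta> (u i)) = (\<Sum>i\<in>I. xi CARD('p) n \<beta> (v i))" for u v t
  proof -
    have "(\<Sum>i\<in>I. xi CARD('p) n \<beta> (v i + t)) = (\<Sum>i\<in>I. xi CARD('p) n \<beta> (v i))"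
      using uv by (simp flip: sum)
    then have "CARD('p) ^ n dvd t" by (rule xi_sum_shift_dvd[OF card basis I(2)])
    moreover have "t < CARD('p) ^ n" using uv[OF i] \<open>u i < T\<close> T by simp
    ultimately show ?thesis using uv[OF i] by (auto dest: dvd_imp_le)
  qed
  have "0 < T" using xy by simp
  from I(1) e xy wrap show ?thesis
  proof (rule cyclic_shifts_const_diff)
    fix t assume "\<And>i. i \<in> I \<Longrightarrow> (y + e i) mod T = (x + e i) mod T + t"
    from shift[of "\<lambda>i. (y + e i) mod T", OF this] show ?thesis using eq \<open>0 < T\<close> by simp
  next
    fix t assume "\<And>i. i \<in> I \<Longrightarrow> (x + e i) mod T = (y + e i) mod T + t"
    from shift[of "\<lambda>i. (x + e i) mod T", OF this] show ?thesis using eq \<open>0 < T\<close> by simp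
  qed
qed

text \<open>For a fixed shift, each exceptional element spoils at most one exponent.\<close>

lemma card_power_shift_le:
  fixes g :: "'a::finite_field"
  assumes "g \<noteq> 0"
  shows "card {x. x < mult_order g \<and> g ^ (x + s) \<in> B} \<le> card B"
proof (rule card_inj_on_le)
  show "inj_on (\<lambda>x. g ^ (x + s)) {x. x < mult_order g \<and> g ^ (x + s) \<in> B}"
    using inj_on_power_mult_order[OF assms] assms by (auto simp: inj_on_def power_add)
qed auto

theorem theorem4p4:
  fixes p n q T m k r :: nat
    and \<gamma> :: "'a::finite_field"
    and G U :: "'a set"
    and \<beta> :: "nat \<Rightarrow> 'a"
    and P F :: "'a \<Rightarrow> 'a"
    and M :: "'a poly"
    and a :: "'a set \<Rightarrow> 'a"
  assumes "prime p" and "CARD('p::prime_card) = p"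
    and "n \<ge> 1" and "q = p ^ n" and "CARD('a) = q"
    and "\<gamma> \<noteq> 0" and "T = mult_order \<gamma>" and "G = cyclic_subgroup \<gamma>"
    and "ordered_fp_basis TYPE('p) n \<beta>"
    and "\<forall>x<T. P (\<gamma> ^ x) = xi p n \<beta> x"
    and "m \<le> T"
    and "card {\<zeta> \<in> G. F \<zeta> \<noteq> P \<zeta>} \<le> m"
    and "module.subspace (fp_scale TYPE('p)) U"
    and "fp_codim TYPE('p) U = k"
    and "linearised p n M"
    and "\<forall>\<zeta>. F \<zeta> = poly M \<zeta> + a (coset U \<zeta>)"
    and "coprime r p"
    and "\<gamma> - 1 \<in> fold_sumset r G"
    and "real m < (real T - 1) / (real r + 2)"
  shows "real p ^ k \<ge>
    ((real T - (real r + 2) * real m - 1) / (real r * real n)) powr (1 / (real r + 1))"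
proof -
  have p: "p = CARD('p)" using assms by simp
  have card: "CARD('a) = CARD('p) ^ n" using assms by simp
  have char: "CHAR('a) = p" using CHAR_eq_prime_card[OF card] p by simp
  interpret vector_space "fp_scale TYPE('p) :: 'p mod_ring \<Rightarrow> 'a \<Rightarrow> 'a"
    by (rule vector_space_fp_scale[OF card])
  note \<gamma> = \<open>\<gamma> \<noteq> 0\<close> and basis = \<open>ordered_fp_basis TYPE('p) n \<beta>\<close>
    and U = \<open>module.subspace (fp_scale TYPE('p)) U\<close>
  have T: "0 < T" "T < p ^ n"
    using mult_order_props[OF \<gamma>] assms by auto
  have inj_power: "inj_on (\<lambda>x. \<gamma> ^ x) {..<T}"
    using inj_on_power_mult_order[OF \<gamma>] assms by simp
  have G: "G = (\<lambda>x. \<gamma> ^ x) ` {..<T}"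
    using cyclic_subgroup_eq[OF \<gamma>] assms by simp
  have power_mod: "\<gamma> ^ (x mod T) = \<gamma> ^ x" for x
    using power_mod_mult_order[OF \<gamma>] assms by simp
  have power_G: "\<gamma> ^ x \<in> G" for x
    unfolding G using T by (intro image_eqI[of _ _ "x mod T"]) (auto simp: power_mod)
  have "r \<noteq> 0" using \<open>coprime r p\<close> \<open>prime p\<close> by (metis coprime_0_left_iff not_prime_unit)

  \<comment> \<open>The relation between powers and the additivity of \<open>M\<close>\<close>
  obtain z where z: "\<gamma> - 1 = (\<Sum>i=1..r. z i)" "\<forall>i\<in>{1..r}. z i \<in> G"
    using \<open>\<gamma> - 1 \<in> fold_sumset r G\<close> by (auto simp: fold_sumset_def)
  have "\<forall>i\<in>{1..r}. \<exists>e. e < T \<and> z i = \<gamma> ^ e" using z(2) by (auto simp: G)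
  then obtain e where e: "\<And>i. i \<in> {1..r} \<Longrightarrow> e i < T" "\<And>i. i \<in> {1..r} \<Longrightarrow> z i = \<gamma> ^ e i"
    by metis
  have "\<gamma> = 1 + (\<Sum>i=1..r. \<gamma> ^ e i)"
    using z(1) e(2) by (simp add: algebra_simps)
  then have "\<gamma> ^ x * \<gamma> = \<gamma> ^ x * (1 + (\<Sum>i=1..r. \<gamma> ^ e i))" for x by simp
  then have power_Suc_eq: "\<gamma> ^ Suc x = \<gamma> ^ x + (\<Sum>i=1..r. \<gamma> ^ (x + e i))" for x
    by (simp add: distrib_left sum_distrib_left power_add mult.commute)

  have M_add: "poly M (x + y) = poly M x + poly M y" for x y
    using poly_linearised_add[of n M] \<open>linearised p n M\<close> char by simp
  then have "poly M 0 = 0" by (metis add_cancel_right_right)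
  with M_add have M_sum: "poly M (sum f A) = (\<Sum>i\<in>A. poly M (f i))" for f and A :: "nat set"
    by (induction A rule: infinite_finite_induct) auto

  define Bad where "Bad = {\<zeta> \<in> G. F \<zeta> \<noteq> P \<zeta>}"
  \<comment> \<open>Index 0 stands for the unshifted exponent, so \<open>\<gamma> ^ x\<close> and
    the \<open>r\<close> shifted powers are treated alike.\<close>
  define s where "s i = (if i = 0 then 0 else e i)" for i
  \<comment> \<open>The bound \<open>T - 1\<close> keeps \<open>Suc x\<close> below
    \<open>T\<close>, so passing from \<open>x\<close> to \<open>Suc x\<close> never wraps.\<close>
  define A where "A = {x. x < T - 1 \<and> \<gamma> ^ Suc x \<notin> Bad \<and> (\<forall>i\<le>r. \<gamma> ^ (x + s i) \<notin> Bad)}"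
  have F_power: "F (\<gamma> ^ x) = xi p n \<beta> (x mod T)" if "\<gamma> ^ x \<notin> Bad" for x
  proof -
    have "F (\<gamma> ^ x) = P (\<gamma> ^ (x mod T))"
      using that power_G[of x] by (simp add: Bad_def power_mod)
    also have "\<dots> = xi p n \<beta> (x mod T)" using assms(10) T by simp
    finally show ?thesis .
  qed
  have A_good: "\<gamma> ^ Suc x \<notin> Bad" "\<gamma> ^ x \<notin> Bad" "i \<in> {1..r} \<Longrightarrow> \<gamma> ^ (x + e i) \<notin> Bad"
    and A_less: "x < T" "Suc x < T" if "x \<in> A" for x i
  proof -
    show "\<gamma> ^ x \<notin> Bad" using that by (force simp: A_def s_def)
    assume "i \<in> {1..r}"
    then show "\<gamma> ^ (x + e i) \<notin> Bad" using that by (force simp: A_def s_def)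
  qed (use that in \<open>auto simp: A_def\<close>)
  have key: "(\<Sum>i=1..r. xi p n \<beta> ((x + e i) mod T))
      = sum \<beta> {i \<in> {1..n}. p ^ (i - 1) dvd Suc x}
        - (a (coset U (\<gamma> ^ Suc x)) - a (coset U (\<gamma> ^ x)) - (\<Sum>i=1..r. a (coset U (\<gamma> ^ (x + e i)))))"
    if "x \<in> A" for x
  proof -
    note good = A_good[OF that]
    have "(\<Sum>i=1..r. F (\<gamma> ^ (x + e i))) = (\<Sum>i=1..r. xi p n \<beta> ((x + e i) mod T))"
      using good(3) by (intro sum.cong) (auto simp: F_power)
    moreover have "F (\<gamma> ^ Suc x) - F (\<gamma> ^ x) = sum \<beta> {i \<in> {1..n}. p ^ (i - 1) dvd Suc x}"
      using F_power[OF good(1)] F_power[OF good(2)] A_less[OF that] xi_Suc[OF card, of \<beta> x]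
      by (simp add: p)
    moreover have "F (\<gamma> ^ Suc x) - F (\<gamma> ^ x) - (\<Sum>i=1..r. F (\<gamma> ^ (x + e i)))
        = a (coset U (\<gamma> ^ Suc x)) - a (coset U (\<gamma> ^ x)) - (\<Sum>i=1..r. a (coset U (\<gamma> ^ (x + e i))))"
    proof -
      have "poly M (\<gamma> ^ Suc x) = poly M (\<gamma> ^ x) + (\<Sum>i=1..r. poly M (\<gamma> ^ (x + e i)))"
        by (simp only: power_Suc_eq M_add M_sum)
      then show ?thesis
        by (simp add: \<open>\<forall>\<zeta>. F \<zeta> = poly M \<zeta> + a (coset U \<zeta>)\<close>[rule_format] sum.distrib del: power_Suc)
    qed
    ultimately show ?thesis by (simp add: algebra_simps)
  qed

  \<comment> \<open>Encoding good exponents by arc, carry length and cosets\<close>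
  define \<Phi> where "\<Phi> x = (card {i \<in> {1..r}. T \<le> x + e i} mod r,
      card {i \<in> {1..n}. p ^ (i - 1) dvd Suc x},
      restrict (\<lambda>i. coset U (\<gamma> ^ (x + s i))) {0..r})" for x
  let ?B = "{..<r} \<times> {1..n} \<times> ({0..r} \<rightarrow>\<^sub>E range (coset U))"
  have "inj_on \<Phi> A"
  proof (rule linorder_inj_onI)
    fix x y assume xy: "x < y" "x \<in> A" "y \<in> A"
    show "\<Phi> x \<noteq> \<Phi> y"
    proof
      assume "\<Phi> x = \<Phi> y"
      then have wrap: "card {i \<in> {1..r}. T \<le> x + e i} mod r = card {i \<in> {1..r}. T \<le> y + e i} mod r"
        and carry: "card {i \<in> {1..n}. p ^ (i - 1) dvd Suc x} = card {i \<in> {1..n}. p ^ (i - 1) dvd Suc y}"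
        and res: "restrict (\<lambda>i. coset U (\<gamma> ^ (x + s i))) {0..r} = restrict (\<lambda>i. coset U (\<gamma> ^ (y + s i))) {0..r}"
        unfolding \<Phi>_def prod.inject by blast+
      have cos: "coset U (\<gamma> ^ (x + s i)) = coset U (\<gamma> ^ (y + s i))" if "i \<in> {0..r}" for i
        using fun_cong[OF res, of i] that by simp
      have cos0: "coset U (\<gamma> ^ x) = coset U (\<gamma> ^ y)" using cos[of 0] by (simp add: s_def)
      have cosi: "coset U (\<gamma> ^ (x + e i)) = coset U (\<gamma> ^ (y + e i))" if "i \<in> {1..r}" for i
        using cos[of i] that by (simp add: s_def)
      \<comment> \<open>The coset of \<open>\<gamma> ^ Suc x\<close> is not recorded in
        \<open>\<Phi>\<close>: the relation between the powers recovers it from the other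
        \<open>r + 1\<close> cosets.\<close>
      have "\<gamma> ^ Suc x - \<gamma> ^ Suc y
          = (\<gamma> ^ x - \<gamma> ^ y) + (\<Sum>i=1..r. \<gamma> ^ (x + e i) - \<gamma> ^ (y + e i))"
        by (simp only: power_Suc_eq sum_subtractf) simp
      also have "\<dots> \<in> U"
        using cos0 cosi by (intro subspace_add[OF U] subspace_sum[OF U])
          (auto simp: coset_eq_iff[OF card U])
      finally have "coset U (\<gamma> ^ Suc x) = coset U (\<gamma> ^ Suc y)"
        by (simp only: coset_eq_iff[OF card U])
      then have "(\<Sum>i=1..r. xi p n \<beta> ((x + e i) mod T)) = (\<Sum>i=1..r. xi p n \<beta> ((y + e i) mod T))"
        unfolding key[OF xy(2)] key[OF xy(3)] power_dvd_filter_card_inject[OF carry]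
        using cos0 cosi by simp
      then have "(x + e 1) mod T = (y + e 1) mod T"
        using xy A_less[of y] e(1) wrap \<open>r \<noteq> 0\<close> T \<open>coprime r p\<close>
        by (intro xi_cyclic_shifts_inject[OF card basis, of "{1..r}"]) (auto simp: p)
      then have "\<gamma> ^ (x + e 1) = \<gamma> ^ (y + e 1)" by (metis power_mod)
      then have "\<gamma> ^ x = \<gamma> ^ y" using \<gamma> by (simp add: power_add)
      then have "x = y" using inj_power xy A_less by (auto simp: inj_on_def)
      with xy show False by simp
    qed
  qed auto
  moreover have "\<Phi> ` A \<subseteq> ?B"
  proof
    fix w assume "w \<in> \<Phi> ` A"
    then obtain x where "w = \<Phi> x" by auto
    moreover have "card {i \<in> {1..n}. p ^ (i - 1) dvd Suc x} \<le> card {1..n}"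
      by (intro card_mono) auto
    \<comment> \<open>Position 1 always changes because \<open>p ^ 0 = 1\<close>, so there are
      \<open>n\<close> carry lengths and not \<open>n + 1\<close>.\<close>
    moreover have "1 \<in> {i \<in> {1..n}. p ^ (i - 1) dvd Suc x}" using \<open>n \<ge> 1\<close> by simp
    then have "card {i \<in> {1..n}. p ^ (i - 1) dvd Suc x} > 0"
      by (subst card_gt_0_iff) auto
    ultimately show "w \<in> ?B" using \<open>r \<noteq> 0\<close> by (simp add: \<Phi>_def)
  qed
  moreover have "finite ?B" by (intro finite_cartesian_product finite_PiE) auto
  ultimately have "card A \<le> card ?B" by (rule card_inj_on_le)
  also have "\<dots> = r * n * card (range (coset U)) ^ (r + 1)"
    by (simp add: card_cartesian_product card_PiE)
  also have "\<dots> \<le> r * n * (p ^ k) ^ (r + 1)"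
    using card_cosets_le[OF card U] \<open>fp_codim TYPE('p) U = k\<close>
    by (intro mult_left_mono power_mono) (auto simp: p)
  finally have upper: "card A \<le> r * n * (p ^ k) ^ (r + 1)" .

  \<comment> \<open>Counting the discarded exponents and taking the root\<close>
  define S where "S d = {x. x < T \<and> \<gamma> ^ (x + d) \<in> Bad}" for d
  have S: "card (S d) \<le> m" "finite (S d)" for d
  proof -
    have "card (S d) \<le> card Bad"
      unfolding S_def \<open>T = mult_order \<gamma>\<close> by (rule card_power_shift_le[OF \<gamma>])
    then show "card (S d) \<le> m" using assms(12) by (simp add: Bad_def)
  qed (simp add: S_def)
  \<comment> \<open>There are \<open>r + 2\<close> shifts: 1 for \<open>Suc x\<close>, 0 for
    \<open>x\<close>, and the \<open>e i\<close>; each discards at most \<open>m\<close>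
    exponents.\<close>
  have "{..<T - 1} \<subseteq> A \<union> (S 1 \<union> (\<Union>i\<in>{0..r}. S (s i)))"
    by (auto simp: A_def S_def)
  then have "card {..<T - 1} \<le> card (A \<union> (S 1 \<union> (\<Union>i\<in>{0..r}. S (s i))))"
    by (rule card_mono[rotated]) (auto simp: A_def S)
  also have "\<dots> \<le> card A + (card (S 1) + (\<Sum>i=0..r. card (S (s i))))"
    by (intro order_trans[OF card_Un_le] add_mono card_UN_le) auto
  also have "\<dots> \<le> card A + (m + (\<Sum>i=0..r. m))"
    using S by (intro add_mono sum_mono) auto
  finally have "T \<le> card A + (r + 2) * m + 1" by (simp add: algebra_simps)
  with upper have "T \<le> r * n * (p ^ k) ^ (r + 1) + (r + 2) * m + 1" by linarith
  then have "real T \<le> real (r * n * (p ^ k) ^ (r + 1) + (r + 2) * m + 1)"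
    by (simp only: of_nat_le_iff)
  then have "real T - (real r + 2) * real m - 1 \<le> (real p ^ k) ^ (r + 1) * (real r * real n)"
    by (simp add: algebra_simps)
  then have le: "(real T - (real r + 2) * real m - 1) / (real r * real n) \<le> (real p ^ k) ^ (r + 1)"
    using \<open>r \<noteq> 0\<close> \<open>n \<ge> 1\<close> by (subst pos_divide_le_eq) auto
  \<comment> \<open>Monotonicity of \<open>powr\<close> needs a nonnegative base; the bound on
    \<open>m\<close> supplies it.\<close>
  have pos: "0 \<le> (real T - (real r + 2) * real m - 1) / (real r * real n)"
    using \<open>real m < (real T - 1) / (real r + 2)\<close> by (simp add: field_simps)
  have "((real T - (real r + 2) * real m - 1) / (real r * real n)) powr (1 / (real r + 1))
      \<le> ((real p ^ k) ^ (r + 1)) powr (1 / (real r + 1))"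
    by (intro powr_mono2 le pos) simp
  also have "\<dots> = (real p ^ k) powr (real (r + 1) * (1 / (real r + 1)))"
    using \<open>prime p\<close> prime_gt_0_nat[of p] by (subst powr_realpow[symmetric]) (simp_all add: powr_powr)
  also have "real (r + 1) * (1 / (real r + 1)) = 1" by simp
  also have "(real p ^ k) powr 1 = real p ^ k" by simp
  finally show ?thesis .
qed

end
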